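(* Let $M$ be the monoid of injective self-maps of $\omega=\{1,2,3,\dots\}$ and let $W$ be a tame $M$-module. (i) Every element of $M$ acts injectively on $W$. (ii) If the filtration of elements of $W$ is bounded (i.e. $W=W^{(n)}$ for some $n\ge 0$), then $W$ is a trivial $M$-module. (iii) If the map $d\in M$ given by $d(i)=i+1$ acts surjectively on $W$, then $W$ is a trivial $M$-module. (iv) If $W$ is finitely generated as an abelian group, then $W$ is a trivial $M$-module.
   Context: $M$ is a monoid under composition. An $M$-module is a left module over the monoid ring $\mathbb Z[M]$; it is trivial if $fx=x$ for all $f\in M$ and all elements $x$. For $n\ge 0$, an element $x$ of an $M$-module $W$ has filtration $n$ if $fx=x$ for every $f\in M$ that fixes $\{1,\dots,n\}$ elementwise; $W^{(n)}\subseteq W$ is the subgroup of elements of filtration $n$. $W$ is tame if $W=\bigcup_{n\ge 0}W^{(n)}$. *)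

theory Defs
  imports
    "HOL-Library.Poly_Mapping"
    "HOL-Computational_Algebra.Group_Closure"
begin

text \<open>
  Injective self-maps of \<open>{1, 2, 3, \<dots>}\<close>. They are represented by functions on
  \<^typ>\<open>nat\<close>; the value at the point \<open>0\<close>, which does not belong to the set, is fixed to
  be \<open>0\<close> so that equality of representatives is equality of self-maps.
\<close>

typedef injmap = "{f :: nat \<Rightarrow> nat. inj_on f {1..} \<and> f ` {1..} \<subseteq> {1..} \<and> f 0 = 0}"
  morphisms app Injmap
  by (rule exI[of _ id]) auto

setup_lifting type_definition_injmap

text \<open>
  The product of a monoid ring is provided by \<^theory>\<open>HOL-Library.Poly_Mapping\<close>, which
  writes the monoid additively. Hence, on \<^typ>\<open>injmap\<close>, \<open>f + g\<close> is the composite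
  \<open>f \<circ> g\<close> (not commutative) and \<open>0\<close> is the identity map.
\<close>

instantiation injmap :: monoid_add
begin

lift_definition zero_injmap :: injmap is "id :: nat \<Rightarrow> nat"
  by auto

lift_definition plus_injmap :: "injmap \<Rightarrow> injmap \<Rightarrow> injmap" is "\<lambda>f g. f \<circ> g"
  by (auto intro!: comp_inj_on intro: inj_on_subset)

instance
  by standard (transfer, simp add: comp_assoc)+

end

lift_definition shift :: injmap is "\<lambda>i :: nat. if i = 0 then 0 else i + 1"
  by (auto simp: inj_on_def)

text \<open>The monoid ring of \<^typ>\<open>injmap\<close> over the integers, with the convolution product.\<close>

type_synonym injmap_ring = "injmap \<Rightarrow>\<^sub>0 int"

text \<open>
  Unital left modules over a ring that need not be commutative (the
  \<open>module\<close> locale of HOL requires a commutative ring).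
\<close>

locale left_module =
  fixes scale :: "'r :: ring_1 \<Rightarrow> 'w :: ab_group_add \<Rightarrow> 'w"
  assumes scale_add_right: "scale a (x + y) = scale a x + scale a y"
    and scale_add_left: "scale (a + b) x = scale a x + scale b x"
    and scale_scale: "scale a (scale b x) = scale (a * b) x"
    and scale_one: "scale 1 x = x"

text \<open>
  An \<open>M\<close>-module is a \<^const>\<open>left_module\<close> over \<^typ>\<open>injmap_ring\<close>; a monoid element acts as
  the corresponding basis element of the monoid ring.
\<close>

definition act :: "(injmap_ring \<Rightarrow> 'w :: ab_group_add \<Rightarrow> 'w) \<Rightarrow> injmap \<Rightarrow> 'w \<Rightarrow> 'w"
  where "act scale f x = scale (Poly_Mapping.single f 1) x"

definition trivial_module :: "(injmap_ring \<Rightarrow> 'w :: ab_group_add \<Rightarrow> 'w) \<Rightarrow> bool"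
  where "trivial_module scale \<longleftrightarrow> (\<forall>f x. act scale f x = x)"

definition filtration :: "(injmap_ring \<Rightarrow> 'w :: ab_group_add \<Rightarrow> 'w) \<Rightarrow> nat \<Rightarrow> 'w set"
  where "filtration scale n =
    {x. \<forall>f. (\<forall>i\<in>{1..n}. app f i = i) \<longrightarrow> act scale f x = x}"

definition tame :: "(injmap_ring \<Rightarrow> 'w :: ab_group_add \<Rightarrow> 'w) \<Rightarrow> bool"
  where "tame scale \<longleftrightarrow> (UNIV :: 'w set) = (\<Union>n. filtration scale n)"

lemma act_zero: "left_module scale \<Longrightarrow> act scale 0 x = x"
  by (simp add: act_def left_module.scale_one)

lemma act_plus: "left_module scale \<Longrightarrow> act scale (f + g) x = act scale f (act scale g x)"
  by (simp add: act_def left_module.scale_scale mult_single)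

lemma act_add: "left_module scale \<Longrightarrow> act scale f (x + y) = act scale f x + act scale f y"
  by (simp add: act_def left_module.scale_add_right)

end

theory Submission
  imports Defs "HOL-Combinatorics.Permutations"
begin

text \<open>
  The restriction of \<open>f\<close> to \<open>{1..n}\<close> extends to a bijection \<open>p\<close>, and \<open>inv p \<circ> f\<close> fixes
  \<open>{1..n}\<close>; so on elements of filtration \<open>n\<close> the map \<open>f\<close> acts like the invertible \<open>p\<close>. This
  gives injectivity, and shows that \<open>f x\<close> depends only on the values of \<open>f\<close> on \<open>{1..n}\<close>.

  If \<open>W = W\<^sup>(\<^sup>n\<^sup>)\<close>, choose \<open>N\<close> so large that \<open>{N+1..N+n}\<close> avoids \<open>{1..n}\<close> and its image under
  \<open>f\<close>, and change \<open>f\<close> off \<open>{1..n}\<close> so that it fixes \<open>{N+1..N+n}\<close>; its conjugate by a bijection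
  extending \<open>i \<mapsto> i + N\<close> fixes \<open>{1..n}\<close>, hence acts trivially.

  If the shift \<open>d\<close> is surjective, write \<open>x\<close> of filtration \<open>n + 1\<close> as \<open>d y\<close>. Every \<open>f\<close> satisfies
  \<open>d \<circ> f = g \<circ> d\<close> with \<open>g 1 = 1\<close>, so by injectivity \<open>y\<close> has filtration \<open>n\<close>; by induction
  \<open>y\<close> is fixed by all of \<open>M\<close>, and \<open>x = d y = y\<close>.
\<close>

section \<open>Extension of finite injections, units of \<open>injmap\<close>, and the shift\<close>

text \<open>\<open>A\<close> and its image under \<open>f\<close> have the same size, hence so do
  their complements in the union; any bijection \<open>h\<close> between these completes
  \<open>f\<close>.\<close>

lemma inj_on_extends_to_permutation:
  assumes "finite A" and "inj_on f A"
  obtains p where "p permutes (A \<union> f ` A)" and "\<And>x. x \<in> A \<Longrightarrow> p x = f x"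
proof -
  let ?B = "A \<union> f ` A"
  have fin: "finite ?B"
    using assms by simp
  have "card (?B - A) = card (?B - f ` A)"
    using assms by (simp add: card_Diff_subset card_image)
  then obtain h where h: "bij_betw h (?B - A) (?B - f ` A)"
    using fin finite_same_card_bij by (metis finite_Diff)
  define p where "p x = (if x \<in> A then f x else if x \<in> ?B then h x else x)" for x
  have "bij_betw p A (f ` A)"
    using assms by (auto simp: p_def bij_betw_def inj_on_def)
  moreover have "bij_betw p (?B - A) (?B - f ` A)"
    using h by (rule iffD1 [OF bij_betw_cong, rotated]) (auto simp: p_def)
  ultimately have "bij_betw p (A \<union> (?B - A)) (f ` A \<union> (?B - f ` A))"
    by (rule bij_betw_combine) auto
  moreover have "A \<union> (?B - A) = ?B" and "f ` A \<union> (?B - f ` A) = ?B"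
    by auto
  ultimately have "p permutes ?B"
    by (intro bij_imp_permutes) (auto simp: p_def)
  then show thesis
    by (rule that) (simp add: p_def)
qed

lemma app_0 [simp]: "app f 0 = 0"
  by transfer simp

lemma app_ge_1: "1 \<le> i \<Longrightarrow> 1 \<le> app f i"
  by transfer auto

lemma inj_on_app: "A \<subseteq> {1..} \<Longrightarrow> inj_on (app f) A"
  by transfer (blast intro: inj_on_subset)

lemma app_zero [simp]: "app 0 i = i"
  by transfer simp

lemma app_plus [simp]: "app (f + g) i = app f (app g i)"
  by transfer simp

lemma injmap_eqI: "(\<And>i. app f i = app g i) \<Longrightarrow> f = g"
  by transfer auto

text \<open>The permutation lives on a finite set that avoids 0, so both it and its inverse
  represent elements of \<open>injmap\<close>.\<close>

lemma extend_to_unit: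
  assumes "finite A" and "inj_on f A" and A: "A \<subseteq> {1..}" and fA: "f ` A \<subseteq> {1..}"
  obtains P Q where "\<And>i. i \<in> A \<Longrightarrow> app P i = f i" and "P + Q = 0" and "Q + P = 0"
proof -
  obtain p where p: "p permutes (A \<union> f ` A)" and pA: "\<And>x. x \<in> A \<Longrightarrow> p x = f x"
    using inj_on_extends_to_permutation assms(1,2) by blast
  have repr: "q \<in> {f. inj_on f {1..} \<and> f ` {1..} \<subseteq> {1..} \<and> f 0 = 0}"
    if q: "q permutes (A \<union> f ` A)" for q
  proof -
    have "0 \<notin> A \<union> f ` A"
      using A fA by force
    then have "q 0 = 0"
      using q by (simp add: permutes_not_in)
    moreover have "inj q"
      using q by (rule permutes_inj)
    ultimately have "q i \<noteq> 0" if "i \<noteq> 0" for i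
      using that by (metis injD)
    with \<open>q 0 = 0\<close> \<open>inj q\<close> show ?thesis
      by (auto intro: inj_on_subset simp: Suc_le_eq)
  qed
  have "app (Injmap p) = p" and "app (Injmap (inv p)) = inv p"
    using repr p permutes_inv by (blast intro: Injmap_inverse)+
  then show thesis
    using p pA
    by (intro that [of "Injmap p" "Injmap (inv p)"] injmap_eqI) (auto simp: permutes_inverses)
qed

lemma shift_plus_eq_plus_shift:
  obtains g where "shift + f = g + shift" and "app g 1 = 1"
proof
  \<comment> \<open>\<open>f\<close> is transported along the shift to \<open>{2..}\<close>, and 1
    is added as a fixed point; the value 0 at 0 is the convention of \<open>injmap\<close>.\<close>
  define h where "h i = (if i \<le> 1 then i else app f (i - 1) + 1)" for i
  have "inj_on h {1..}"
  proof (rule inj_onI)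
    fix i j assume ij: "i \<in> {1..}" "j \<in> {1..}" "h i = h j"
    have pos: "1 \<le> app f (k - 1)" if "1 < k" for k
      using that by (intro app_ge_1) auto
    consider "i = 1" "j = 1" | "i = 1" "1 < j" | "1 < i" "j = 1" | "1 < i" "1 < j"
      using ij by fastforce
    then show "i = j"
    proof cases
      case 4
      then have "app f (i - 1) = app f (j - 1)"
        using ij by (simp add: h_def)
      then have "i - 1 = j - 1"
        by (rule inj_onD [OF inj_on_app [OF order_refl]]) (use 4 in auto)
      then show ?thesis
        using 4 by simp
    qed (use ij pos [of i] pos [of j] in \<open>auto simp: h_def\<close>)
  qed
  then have h: "app (Injmap h) = h"
    by (intro Injmap_inverse) (auto simp: h_def)
  show "app (Injmap h) 1 = 1"
    by (simp add: h h_def)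
  show "shift + f = Injmap h + shift"
  proof (rule injmap_eqI)
    fix i
    show "app (shift + f) i = app (Injmap h + shift) i"
      using app_ge_1 [of i f] by (cases "i = 0") (auto simp: h h_def shift.rep_eq)
  qed
qed

section \<open>Filtration and the action of units\<close>

lemma filtration_eq:
  "x \<in> filtration scale n \<Longrightarrow> (\<And>i. i \<in> {1..n} \<Longrightarrow> app f i = i) \<Longrightarrow> act scale f x = x"
  by (simp add: filtration_def)

lemma filtration_mono: "m \<le> n \<Longrightarrow> filtration scale m \<subseteq> filtration scale n"
  by (auto simp: filtration_def)

lemma trivial_module_iff_filtration_0: "trivial_module scale \<longleftrightarrow> filtration scale 0 = UNIV"
  by (auto simp: trivial_module_def filtration_def)

context
  fixes scale :: "injmap_ring \<Rightarrow> 'w :: ab_group_add \<Rightarrow> 'w"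
  assumes module: "left_module scale"
begin

lemma act_0: "act scale f 0 = 0"
  using act_add [OF module, of f 0 0] by simp

lemma act_diff: "act scale f (x - y) = act scale f x - act scale f y"
  using act_add [OF module, of f "x - y" y] by (simp add: algebra_simps)

text \<open>Each filtration step is a subgroup because the action is additive.\<close>

lemma group_closure_subset_filtration:
  assumes "S \<subseteq> filtration scale n"
  shows "group_closure S \<subseteq> filtration scale n"
proof
  fix x assume "x \<in> group_closure S"
  then show "x \<in> filtration scale n"
    by induction (use assms in \<open>auto simp: filtration_def act_0 act_diff\<close>)
qed

lemma act_agrees_with_unit:
  assumes x: "x \<in> filtration scale n" and "P + Q = 0" "Q + P = 0"
    and agree: "\<And>i. i \<in> {1..n} \<Longrightarrow> app P i = app f i"
  shows "act scale f x = act scale P x"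
proof -
  have "app (Q + f) i = i" if "i \<in> {1..n}" for i
  proof -
    have "app (Q + f) i = app (Q + P) i"
      using agree that by simp
    then show ?thesis
      using assms by simp
  qed
  with x have "act scale (Q + f) x = x"
    by (rule filtration_eq)
  then have "act scale P x = act scale (P + Q + f) x"
    by (simp add: add.assoc act_plus [OF module])
  then show ?thesis
    using assms by simp
qed

lemma unit_agreeing_on_atLeastAtMost:
  obtains P Q where "\<And>i. i \<in> {1..n} \<Longrightarrow> app P i = app f i" "P + Q = 0" "Q + P = 0"
  by (rule extend_to_unit [of "{1..n}" "app f"]) (auto intro: inj_on_app app_ge_1 [unfolded One_nat_def])

text \<open>A single unit extending the common values on \<open>{1..n}\<close> computes both
  sides.\<close>

lemma act_cong_filtration:
  assumes "x \<in> filtration scale n" and "\<And>i. i \<in> {1..n} \<Longrightarrow> app f i = app g i"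
  shows "act scale f x = act scale g x"
proof -
  obtain P Q where "\<And>i. i \<in> {1..n} \<Longrightarrow> app P i = app f i" "P + Q = 0" "Q + P = 0"
    using unit_agreeing_on_atLeastAtMost by blast
  then show ?thesis
    using assms act_agrees_with_unit by metis
qed

lemma act_unit_cancel: "Q + P = 0 \<Longrightarrow> act scale Q (act scale P x) = x"
  by (simp add: act_zero [OF module] flip: act_plus [OF module])

lemma inj_act:
  assumes "tame scale"
  shows "inj (act scale f)"
proof (rule injI)
  fix x y assume eq: "act scale f x = act scale f y"
  \<comment> \<open>The filtration of the difference is what counts: \<open>f\<close> acts on
    \<open>x - y\<close> as a unit.\<close>
  obtain n where n: "x - y \<in> filtration scale n"
    using assms unfolding tame_def by blast
  obtain P Q where PQ: "\<And>i. i \<in> {1..n} \<Longrightarrow> app P i = app f i" "P + Q = 0" "Q + P = 0"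
    using unit_agreeing_on_atLeastAtMost by blast
  then have "act scale P (x - y) = act scale f (x - y)"
    using n act_agrees_with_unit by metis
  also have "\<dots> = 0"
    using eq by (simp add: act_diff)
  finally have "act scale Q 0 = x - y"
    using PQ act_unit_cancel by metis
  then show "x = y"
    by (simp add: act_0)
qed

section \<open>Three criteria for triviality\<close>

lemma bounded_filtration_imp_trivial:
  assumes bounded: "filtration scale n = UNIV"
  shows "trivial_module scale"
  unfolding trivial_module_def
proof (intro allI)
  fix f y
  \<comment> \<open>The block \<open>{N+1..N+n}\<close> will lie beyond \<open>{1..n}\<close> and
    its image under \<open>f\<close>. For \<open>n = 0\<close> the bound is vacuous, whatever
    \<open>Max\<close> of the empty set is.\<close>
  obtain N where N: "\<And>i. i \<in> {1..n} \<Longrightarrow> i \<le> N \<and> app f i \<le> N"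
  proof
    fix i assume "i \<in> {1..n}"
    then show "i \<le> Max ({1..n} \<union> app f ` {1..n}) \<and> app f i \<le> Max ({1..n} \<union> app f ` {1..n})"
      by (intro conjI Max_ge) auto
  qed
  let ?F = "\<lambda>i. if i \<le> n then app f i else i"
  have inj: "inj_on ?F ({1..n} \<union> {N+1..N+n})"
  proof (rule inj_onI)
    fix i j assume "i \<in> {1..n} \<union> {N+1..N+n}" "j \<in> {1..n} \<union> {N+1..N+n}" "?F i = ?F j"
    moreover have "i = j" if "i \<in> {1..n}" "j \<in> {1..n}" "app f i = app f j"
      using that inj_on_app [of "{1..n}" f] by (auto dest: inj_onD)
    ultimately show "i = j"
      using N [of i] N [of j] by (auto split: if_splits)
  qed
  obtain F where F: "\<And>i. i \<in> {1..n} \<union> {N+1..N+n} \<Longrightarrow> app F i = ?F i"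
    by (rule extend_to_unit [OF _ inj]) (auto intro: app_ge_1 [unfolded One_nat_def])
  obtain P Q where P: "\<And>i. i \<in> {1..n} \<Longrightarrow> app P i = i + N" and PQ: "P + Q = 0" "Q + P = 0"
    by (rule extend_to_unit [of "{1..n}" "\<lambda>i. i + N"]) auto
  \<comment> \<open>\<open>P\<close> moves \<open>{1..n}\<close> onto the block, \<open>F\<close>
    fixes the block, and \<open>Q\<close> moves it back.\<close>
  have "app (Q + (F + P)) i = i" if i: "i \<in> {1..n}" for i
  proof -
    have "app F (i + N) = i + N"
    proof -
      have "n \<le> N"
        using N [of n] i by simp
      then show ?thesis
        using F [of "i + N"] i by simp
    qed
    then have "app (Q + (F + P)) i = app (Q + P) i"
      using P i by simp
    then show ?thesis
      using PQ by simp
  qed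
  \<comment> \<open>Boundedness is applied to \<open>Q y\<close>, not to \<open>y\<close>: acting
    with \<open>P\<close> then cancels both pairs and leaves \<open>F y = y\<close>.\<close>
  then have "act scale (Q + (F + P)) (act scale Q y) = act scale Q y"
    using bounded by (intro filtration_eq [of _ _ n]) auto
  then have "act scale P (act scale (Q + (F + P)) (act scale Q y)) = y"
    using PQ by (simp add: act_unit_cancel)
  then have "act scale F y = y"
    using PQ by (simp add: act_plus [OF module] act_unit_cancel)
  moreover have "act scale f y = act scale F y"
    using bounded F by (intro act_cong_filtration [of _ n]) auto
  ultimately show "act scale f y = y"
    by simp
qed

text \<open>If \<open>f\<close> fixes \<open>{1..n}\<close>, then its transport \<open>g\<close>
  along the shift fixes \<open>{1..Suc n}\<close>, so \<open>f y\<close> and \<open>y\<close> have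
  the same image under \<open>shift\<close>.\<close>

lemma filtration_shiftD:
  assumes "inj (act scale shift)" and y: "act scale shift y \<in> filtration scale (Suc n)"
  shows "y \<in> filtration scale n"
  unfolding filtration_def
proof (intro CollectI allI impI)
  fix f assume f: "\<forall>i\<in>{1..n}. app f i = i"
  obtain g where g: "shift + f = g + shift" "app g 1 = 1"
    by (rule shift_plus_eq_plus_shift)
  have "app g i = i" if "i \<in> {1..Suc n}" for i
  proof (cases "i = 1")
    case False
    then have "i - 1 \<in> {1..n}"
      using that by auto
    \<comment> \<open>As \<open>i - 1\<close> is positive, the two sides are
      \<open>f (i - 1) + 1 = i\<close> and \<open>g i\<close>.\<close>
    moreover have "app (shift + f) (i - 1) = app (g + shift) (i - 1)"
      using g by simp
    ultimately show ?thesis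
      using f that False by (simp add: shift.rep_eq)
  qed (use g in simp)
  then have "act scale g (act scale shift y) = act scale shift y"
    by (rule filtration_eq [OF y])
  then have "act scale shift (act scale f y) = act scale shift y"
    using g by (simp flip: act_plus [OF module])
  then show "act scale f y = y"
    using assms(1) by (simp add: inj_eq)
qed

lemma surj_shift_imp_trivial:
  assumes tame: "tame scale" and surj: "surj (act scale shift)"
  shows "trivial_module scale"
proof -
  have "x \<in> filtration scale 0" if "x \<in> filtration scale n" for x n
    using that
  proof (induction n arbitrary: x)
    case (Suc n)
    obtain y where y: "x = act scale shift y"
      using surj by (rule surjE)
    then have "y \<in> filtration scale 0"
      using Suc filtration_shiftD inj_act [OF tame] by blast
    \<comment> \<open>Filtration 0 means fixed by every element of \<open>injmap\<close>, in
      particular by \<open>shift\<close>.\<close>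
    moreover from this have "x = y"
      using y filtration_eq [of y scale 0 shift] by simp
    ultimately show ?case
      by simp
  qed
  then show ?thesis
    using tame unfolding trivial_module_iff_filtration_0 tame_def by blast
qed

text \<open>The filtration steps are nested subgroups, so the largest degree chosen for a generator
  serves for the whole group.\<close>

lemma finitely_generated_imp_bounded_filtration:
  assumes tame: "tame scale" and "finite S" and S: "group_closure S = (UNIV :: 'w set)"
  obtains n where "filtration scale n = UNIV"
proof -
  obtain k where k: "\<And>x. x \<in> filtration scale (k x)"
    using tame unfolding tame_def by (metis UN_iff UNIV_I)
  have "S \<subseteq> filtration scale (Max (k ` S))"
  proof
    fix x assume "x \<in> S"
    then have "k x \<le> Max (k ` S)"
      using \<open>finite S\<close> by simp
    then show "x \<in> filtration scale (Max (k ` S))"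
      using k filtration_mono by blast
  qed
  then have "filtration scale (Max (k ` S)) = UNIV"
    using group_closure_subset_filtration S by blast
  then show thesis
    by (rule that)
qed

end

theorem lemma2p3:
  fixes scale :: "injmap_ring \<Rightarrow> 'w :: ab_group_add \<Rightarrow> 'w"
  assumes "left_module scale" and "tame scale"
  shows "(\<forall>f. inj (act scale f)) \<and>
    ((\<exists>n. (UNIV :: 'w set) = filtration scale n) \<longrightarrow> trivial_module scale) \<and>
    (surj (act scale shift) \<longrightarrow> trivial_module scale) \<and>
    ((\<exists>S :: 'w set. finite S \<and> group_closure S = UNIV) \<longrightarrow> trivial_module scale)"
proof (intro conjI impI allI)
  show "inj (act scale f)" for f
    using assms by (rule inj_act)
  show "trivial_module scale" if "\<exists>n. UNIV = filtration scale n"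
    using that bounded_filtration_imp_trivial [OF assms(1)] by auto
  show "trivial_module scale" if "surj (act scale shift)"
    using assms that by (rule surj_shift_imp_trivial)
  show "trivial_module scale" if fg: "\<exists>S :: 'w set. finite S \<and> group_closure S = UNIV"
  proof -
    obtain n where "filtration scale n = UNIV"
      using fg finitely_generated_imp_bounded_filtration [OF assms] by blast
    then show ?thesis
      by (rule bounded_filtration_imp_trivial [OF assms(1)])
  qed
qed

end
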